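(* Let $G=(\mathcal N,\mathcal L,c)$ be a connected weighted graph and let $\mathbf T$ be a random spanning tree of $G$. Then for every node $i\in\mathcal N$ the node resistance curvature equals the expected combinatorial curvature of $i$ in $\mathbf T$: $$p_i=\mathbb E\big[p_i^{(co)}(\mathbf T)\big].$$
   Context: A weighted graph $G=(\mathcal N,\mathcal L,c)$ is a finite simple undirected graph without self-loops, with $n$ nodes $\mathcal N$, links $\mathcal L$, and positive link weights $c_{ij}=c_{ji}>0$ for $(i,j)\in\mathcal L$; write $i\sim j$ if $(i,j)\in\mathcal L$. The Laplacian $Q$ is the $n\times n$ matrix with $Q_{ij}=-c_{ij}$ if $i\sim j$, $Q_{ii}=\sum_{j\sim i}c_{ij}$, and $0$ otherwise; $Q^\dagger$ is its Moore-Penrose pseudoinverse. The effective resistance is $\omega_{ij}=(\mathbf e_i-\mathbf e_j)^TQ^\dagger(\mathbf e_i-\mathbf e_j)$, where $\mathbf e_i$ is the $i$-th unit vector. The node resistance curvature is $p_i=1-\frac12\sum_{j\sim i}c_{ij}\omega_{ij}$. Let $\mathcal T$ be the set of spanning trees of $G$. A random spanning tree $\mathbf T$ is a random element of $\mathcal T$ with $\Pr[\mathbf T=T]=c(T)/\sum_{T'\in\mathcal T}c(T')$, where $c(T)=\prod_{(i,j)\in\mathcal L(T)}c_{ij}$ is the product of the link weights of $T$. For a graph embedded in the plane, the combinatorial curvature of a node $i$ is $p_i^{(co)}=1-\frac{d_i}{2}+\sum_{f\ni i}\frac1{d_f}$, where $d_i$ is the number of links incident to $i$, the sum is over faces $f$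 having $i$ on their boundary, and the unbounded face of a tree contributes nothing. Hence for a tree $T$ one has $p_i^{(co)}(T)=1-\frac{d_i^{(T)}}{2}$, where $d_i^{(T)}$ is the number of links of $T$ incident to $i$. *)

theory Defs
  imports "HOL-Probability.Probability"
begin

section \<open>Weighted graphs\<close>

text \<open>
  The nodes are all elements of a finite type; a link is an unordered pair of distinct nodes, so
  that the weight \<open>c {i, j}\<close> is symmetric by construction.
\<close>

definition weighted_graph :: "'n::finite set set \<Rightarrow> ('n set \<Rightarrow> real) \<Rightarrow> bool" where
  "weighted_graph L c \<longleftrightarrow> (\<forall>e\<in>L. card e = 2 \<and> c e > 0)"

definition graph_connected :: "'n set set \<Rightarrow> bool" where
  "graph_connected E \<longleftrightarrow> (\<forall>u v. (u, v) \<in> {(x, y). {x, y} \<in> E}\<^sup>*)"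

definition is_cycle :: "'n set set \<Rightarrow> 'n list \<Rightarrow> bool" where
  "is_cycle E vs \<longleftrightarrow> length vs \<ge> 3 \<and> distinct vs \<and>
     (\<forall>k. Suc k < length vs \<longrightarrow> {vs ! k, vs ! Suc k} \<in> E) \<and> {last vs, hd vs} \<in> E"

text \<open>
  Connectedness refers to the whole node type, so a tree \<open>T \<subseteq> L\<close> is automatically spanning.
\<close>

definition is_tree :: "'n set set \<Rightarrow> bool" where
  "is_tree E \<longleftrightarrow> graph_connected E \<and> \<not> (\<exists>vs. is_cycle E vs)"

definition spanning_trees :: "'n set set \<Rightarrow> 'n set set set" where
  "spanning_trees L = {T. T \<subseteq> L \<and> is_tree T}"

definition degree :: "'n set set \<Rightarrow> 'n \<Rightarrow> nat" where
  "degree E i = card {e\<in>E. i \<in> e}"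


section \<open>Effective resistance and node resistance curvature\<close>

definition laplacian :: "'n::finite set set \<Rightarrow> ('n set \<Rightarrow> real) \<Rightarrow> real^'n^'n" where
  "laplacian L c = (\<chi> i j.
     if i = j then (\<Sum>k | {i, k} \<in> L. c {i, k})
     else if {i, j} \<in> L then - c {i, j} else 0)"

definition is_moore_penrose_inverse :: "real^'n^'m \<Rightarrow> real^'m^'n \<Rightarrow> bool" where
  "is_moore_penrose_inverse A X \<longleftrightarrow>
     A ** X ** A = A \<and> X ** A ** X = X \<and>
     transpose (A ** X) = A ** X \<and> transpose (X ** A) = X ** A"

definition moore_penrose_inverse :: "real^'n^'m \<Rightarrow> real^'m^'n" where
  "moore_penrose_inverse A = (THE X. is_moore_penrose_inverse A X)"

definition effective_resistance ::
  "'n::finite set set \<Rightarrow> ('n set \<Rightarrow> real) \<Rightarrow> 'n \<Rightarrow> 'n \<Rightarrow> real" where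
  "effective_resistance L c i j =
     (axis i 1 - axis j 1) \<bullet> (moore_penrose_inverse (laplacian L c) *v (axis i 1 - axis j 1))"

definition node_resistance_curvature ::
  "'n::finite set set \<Rightarrow> ('n set \<Rightarrow> real) \<Rightarrow> 'n \<Rightarrow> real" where
  "node_resistance_curvature L c i =
     1 - 1/2 * (\<Sum>j | {i, j} \<in> L. c {i, j} * effective_resistance L c i j)"


section \<open>Random spanning trees\<close>

definition tree_weight :: "('n set \<Rightarrow> real) \<Rightarrow> 'n set set \<Rightarrow> real" where
  "tree_weight c T = (\<Prod>e\<in>T. c e)"

definition random_spanning_tree ::
  "'w measure \<Rightarrow> 'n::finite set set \<Rightarrow> ('n set \<Rightarrow> real) \<Rightarrow> ('w \<Rightarrow> 'n set set) \<Rightarrow> bool" where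
  "random_spanning_tree M L c X \<longleftrightarrow>
     prob_space M \<and> X \<in> M \<rightarrow>\<^sub>M count_space (spanning_trees L) \<and>
     (\<forall>T\<in>spanning_trees L. measure M {w \<in> space M. X w = T} =
        tree_weight c T / (\<Sum>T'\<in>spanning_trees L. tree_weight c T'))"


section \<open>Combinatorial curvature of a plane graph\<close>

text \<open>
  An embedding in the plane places the nodes at distinct points \<open>\<phi> i\<close> and draws every link
  \<open>e\<close> as an arc \<open>\<gamma> e\<close> between its end points; arcs meet nodes and other arcs only at
  common end points.
\<close>

definition plane_embedding ::
  "'n set set \<Rightarrow> ('n \<Rightarrow> complex) \<Rightarrow> ('n set \<Rightarrow> real \<Rightarrow> complex) \<Rightarrow> bool" where
  "plane_embedding E \<phi> \<gamma> \<longleftrightarrow>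
     inj \<phi> \<and>
     (\<forall>e\<in>E. arc (\<gamma> e) \<and> {pathstart (\<gamma> e), pathfinish (\<gamma> e)} = \<phi> ` e \<and>
             path_image (\<gamma> e) \<inter> range \<phi> = \<phi> ` e) \<and>
     (\<forall>e\<in>E. \<forall>e'\<in>E. e \<noteq> e' \<longrightarrow> path_image (\<gamma> e) \<inter> path_image (\<gamma> e') = \<phi> ` (e \<inter> e'))"

definition faces ::
  "'n set set \<Rightarrow> ('n \<Rightarrow> complex) \<Rightarrow> ('n set \<Rightarrow> real \<Rightarrow> complex) \<Rightarrow> complex set set" where
  "faces E \<phi> \<gamma> = components (- (range \<phi> \<union> (\<Union>e\<in>E. path_image (\<gamma> e))))"

text \<open>
  The number of links on the boundary of \<open>f\<close>, where a link having \<open>f\<close> on both of its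
  sides (i.e. lying on the boundary of no other face) is counted twice.
\<close>

definition face_degree ::
  "'n set set \<Rightarrow> ('n \<Rightarrow> complex) \<Rightarrow> ('n set \<Rightarrow> real \<Rightarrow> complex) \<Rightarrow> complex set \<Rightarrow> nat" where
  "face_degree E \<phi> \<gamma> f =
     (\<Sum>e | e \<in> E \<and> path_image (\<gamma> e) \<subseteq> frontier f.
        if \<exists>g\<in>faces E \<phi> \<gamma>. g \<noteq> f \<and> path_image (\<gamma> e) \<subseteq> frontier g then 1 else 2)"

text \<open>
  The unbounded face contributes to the curvature, except when the graph is a tree.
\<close>

definition combinatorial_curvature ::
  "'n set set \<Rightarrow> ('n \<Rightarrow> complex) \<Rightarrow> ('n set \<Rightarrow> real \<Rightarrow> complex) \<Rightarrow> 'n \<Rightarrow> real" where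
  "combinatorial_curvature E \<phi> \<gamma> i =
     1 - degree E i / 2 +
     (\<Sum>f | f \<in> faces E \<phi> \<gamma> \<and> \<phi> i \<in> frontier f \<and> \<not> (is_tree E \<and> \<not> bounded f).
        1 / face_degree E \<phi> \<gamma> f)"

end

theory Submission
  imports Defs
begin

text \<open>
  The face terms of the combinatorial curvature disappear for a tree: a plane tree does not separate
  the plane (lemma \<open>tree_complement_connected\<close>), so its only face is the unbounded one, which a tree
  does not count. Thus its curvature is \<open>1 - d\<^sub>i(T)/2\<close>. By linearity of expectation
  the theorem becomes \<open>E[d\<^sub>i(T)] = \<Sum>\<^sub>j c\<^sub>i\<^sub>j \<omega>\<^sub>i\<^sub>j\<close>, and this holds term by term:
  by Kirchhoff's formula (\<open>link_weight_times_resistance\<close>) \<open>c\<^sub>i\<^sub>j \<omega>\<^sub>i\<^sub>j\<close> is the probability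
  that the link \<open>{i, j}\<close> belongs to the random spanning tree.

  Kirchhoff's formula is proved without determinants. For nodes \<open>a\<close>, \<open>b\<close> let \<open>V(x)\<close> be the total
  weight of the spanning forests with two components that separate \<open>a\<close> from \<open>b\<close> and have \<open>x\<close> on the
  side of \<open>a\<close>. Adding a link \<open>{x, y}\<close> between the two components turns such a forest into a spanning
  tree whose path from \<open>a\<close> to \<open>b\<close> uses that link. Hence \<open>c\<^sub>x\<^sub>y (V(x) - V(y))\<close> is the net number of
  traversals of the link from \<open>x\<close> to \<open>y\<close> by the tree paths from \<open>a\<close> to \<open>b\<close>, weighted by \<open>c(T)\<close>
  (\<open>forest_potential_drop\<close>). Each path is a unit flow, so summing over \<open>y\<close> gives
  \<open>Q V = Z (e\<^sub>a - e\<^sub>b)\<close> with \<open>Z = \<Sum>\<^sub>T c(T)\<close> (\<open>laplacian_forest_potential\<close>). Any such solution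
  computes the resistance, \<open>\<omega>\<^sub>a\<^sub>b = (V(a) - V(b)) / Z\<close> (\<open>effective_resistance_potential\<close>), and the
  same solutions for all pairs provide the pseudoinverse of \<open>Q\<close>.
\<close>

section \<open>Reachability along links\<close>

definition reachable :: "'n set set \<Rightarrow> 'n \<Rightarrow> 'n \<Rightarrow> bool" where
  "reachable E x y \<longleftrightarrow> (x, y) \<in> {(x, y). {x, y} \<in> E}\<^sup>*"

lemma graph_connected_iff_reachable: "graph_connected E \<longleftrightarrow> (\<forall>x y. reachable E x y)"
  by (simp add: graph_connected_def reachable_def)

lemma reachable_refl [simp]: "reachable E x x"
  by (simp add: reachable_def)

lemma reachable_link: "{x, y} \<in> E \<Longrightarrow> reachable E x y"
  by (auto simp: reachable_def)

lemma reachable_trans: "reachable E x y \<Longrightarrow> reachable E y z \<Longrightarrow> reachable E x z"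
  unfolding reachable_def by (rule rtrancl_trans)

lemma reachable_sym: "reachable E x y \<Longrightarrow> reachable E y x"
proof -
  have "sym {(x, y). {x, y} \<in> E}"
    by (auto simp: sym_def insert_commute)
  then show "reachable E x y \<Longrightarrow> reachable E y x"
    unfolding reachable_def by (meson symD sym_rtrancl)
qed

lemma reachable_join: "reachable E z x \<Longrightarrow> reachable E z y \<Longrightarrow> reachable E x y"
  by (rule reachable_trans[OF reachable_sym])

lemma graph_connectedI: "(\<And>x. reachable E r x) \<Longrightarrow> graph_connected E"
  unfolding graph_connected_iff_reachable by (intro allI, rule reachable_join)

lemma reachable_mono: "reachable E x y \<Longrightarrow> E \<subseteq> F \<Longrightarrow> reachable F x y"
  unfolding reachable_def by (rule rtrancl_mono[THEN subsetD]) auto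

lemma reachable_induct [consumes 1, case_names refl step]:
  assumes "reachable E x y" and "P x"
    and "\<And>y z. reachable E x y \<Longrightarrow> {y, z} \<in> E \<Longrightarrow> P y \<Longrightarrow> P z"
  shows "P y"
  using assms(1)[unfolded reachable_def]
proof (induction rule: rtrancl_induct)
  case base
  show ?case by (rule assms(2))
next
  case (step y z)
  then show ?case using assms(3)[of y z] by (simp add: reachable_def)
qed

text \<open>
  A walk that uses the additional link can be cut before its first and after its last use of it,
  so at most one crossing of that link remains.
\<close>

lemma reachable_insertD:
  assumes "reachable (insert {x, y} E) u v"
  shows "reachable E u v \<or> reachable E u x \<and> reachable E y v \<or> reachable E u y \<and> reachable E x v"
  using assms
proof (induction rule: reachable_induct)
  case refl
  then show ?case by simp
next
  case (step v w)
  show ?case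
  proof (cases "{v, w} = {x, y}")
    case True
    then have "v = x \<and> w = y \<or> v = y \<and> w = x"
      by (auto simp: doubleton_eq_iff)
    then show ?thesis
      using step.IH by auto
  next
    case False
    then have "reachable E v w"
      using step.hyps by (intro reachable_link) auto
    then show ?thesis
      using step.IH reachable_trans[of E _ v w] by blast
  qed
qed

lemma reachable_one_end_of_removed_link:
  assumes "graph_connected T" and "{x, y} \<in> T"
  shows "reachable (T - {{x, y}}) z x \<or> reachable (T - {{x, y}}) z y"
proof -
  have "reachable (insert {x, y} (T - {{x, y}})) z x"
    using assms by (simp add: graph_connected_iff_reachable insert_absorb)
  from reachable_insertD[OF this] show ?thesis
    by auto
qed

lemma graph_connected_remove_link:
  assumes "graph_connected T" and "reachable (T - {{x, y}}) x y"
  shows "graph_connected (T - {{x, y}})"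
  unfolding graph_connected_iff_reachable
proof (intro allI)
  fix u v
  have "reachable (insert {x, y} (T - {{x, y}})) u v"
    using assms(1) reachable_mono[of T u v "insert {x, y} T"]
    by (auto simp: graph_connected_iff_reachable)
  from reachable_insertD[OF this] show "reachable (T - {{x, y}}) u v"
    using assms(2) by (meson reachable_sym reachable_trans)
qed

lemma reachable_imp_simple_path:
  assumes "reachable E x y"
  obtains vs where "vs \<noteq> []" "distinct vs" "hd vs = x" "last vs = y"
    "\<And>k. Suc k < length vs \<Longrightarrow> {vs ! k, vs ! Suc k} \<in> E"
proof -
  have "\<exists>vs. vs \<noteq> [] \<and> distinct vs \<and> hd vs = x \<and> last vs = y \<and>
    (\<forall>k. Suc k < length vs \<longrightarrow> {vs ! k, vs ! Suc k} \<in> E)"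
    using assms
  proof (induction rule: reachable_induct)
    case refl
    show ?case by (rule exI[of _ "[x]"]) simp
  next
    case (step y z)
    then obtain vs where vs: "vs \<noteq> []" "distinct vs" "hd vs = x" "last vs = y"
      "\<forall>k. Suc k < length vs \<longrightarrow> {vs ! k, vs ! Suc k} \<in> E" by blast
    show ?case
    proof (cases "z \<in> set vs")
      case True
      then obtain k where k: "k < length vs" "vs ! k = z"
        by (auto simp: in_set_conv_nth)
      have "last (take (Suc k) vs) = z"
        using k by (simp add: take_Suc_conv_app_nth)
      then show ?thesis
        using vs k by (intro exI[of _ "take (Suc k) vs"]) (auto simp: hd_take)
    next
      case False
      have "{(vs @ [z]) ! k, (vs @ [z]) ! Suc k} \<in> E" if "Suc k < length (vs @ [z])" for k
      proof (cases "Suc k < length vs")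
        case True
        then show ?thesis using vs by (simp add: nth_append)
      next
        case False
        then have "k = length vs - 1" "Suc k = length vs" using that by auto
        then show ?thesis using vs step by (simp add: nth_append last_conv_nth)
      qed
      then show ?thesis
        using vs False by (intro exI[of _ "vs @ [z]"]) auto
    qed
  qed
  then show thesis using that by blast
qed


section \<open>Trees as connected graphs with the least number of links\<close>

text \<open>
  An induction principle: a spanning tree of a connected graph arises from a single node by
  repeatedly attaching a new node by one link, so a property \<open>P\<close> of the pair (nodes reached,
  links used) that survives such steps holds for it. With a trivial \<open>P\<close> this bounds the number of
  links of a connected graph; with a topological \<open>P\<close> it controls the complement of a drawing.
\<close>

lemma grow_spanning_tree:
  fixes E :: "'n::finite set set"
  assumes "graph_connected E" and "P {r} {}"
    and grow: "\<And>V F u v. P V F \<Longrightarrow> F \<subseteq> E \<Longrightarrow> \<Union>F \<subseteq> V \<Longrightarrow> u \<in> V \<Longrightarrow> v \<notin> V \<Longrightarrow> {u, v} \<in> E \<Longrightarrow>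
      P (insert v V) (insert {u, v} F)"
  obtains F where "F \<subseteq> E" "graph_connected F" "card F + 1 = CARD('n)" "P UNIV F"
proof -
  define ok where "ok V F \<longleftrightarrow> P V F \<and> F \<subseteq> E \<and> \<Union>F \<subseteq> V \<and> r \<in> V \<and>
    (\<forall>v\<in>V. reachable F r v) \<and> card F + 1 = card V" for V F
  have "\<exists>V F. ok V F \<and> card V = Suc k" if "Suc k \<le> CARD('n)" for k
    using that
  proof (induction k)
    case 0
    have "ok {r} {}" using assms(2) by (simp add: ok_def)
    then show ?case by (metis One_nat_def card_1_singleton_iff)
  next
    case (Suc k)
    then obtain V F where ok: "ok V F" and V: "card V = Suc k" by auto
    then have "V \<noteq> UNIV" using Suc.prems by auto
    then obtain w where "w \<notin> V" by blast
    have "w \<in> V \<or> (\<exists>u v. u \<in> V \<and> v \<notin> V \<and> {u, v} \<in> E)" if "reachable E r w" for w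
      using that
      by (induction rule: reachable_induct) (use ok in \<open>auto simp: ok_def\<close>)
    then obtain u v where uv: "u \<in> V" "v \<notin> V" "{u, v} \<in> E"
      using assms(1) \<open>w \<notin> V\<close> unfolding graph_connected_iff_reachable by blast
    let ?F = "insert {u, v} F"
    have "{u, v} \<notin> F" using ok uv by (auto simp: ok_def)
    have old: "reachable ?F r z" if "z \<in> V" for z
      using ok that reachable_mono[of F r z ?F] by (auto simp: ok_def)
    have "reachable ?F r v"
      using reachable_trans[OF old[OF uv(1)] reachable_link[of u v ?F]] by simp
    moreover have "P (insert v V) ?F"
      using ok uv by (intro grow) (auto simp: ok_def)
    moreover have "card ?F + 1 = card (insert v V)"
      using ok uv \<open>{u, v} \<notin> F\<close> by (simp add: ok_def)
    moreover have "?F \<subseteq> E" "\<Union>?F \<subseteq> insert v V"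
      using ok uv by (auto simp: ok_def)
    ultimately have "ok (insert v V) ?F"
      using ok old by (simp add: ok_def)
    moreover have "card (insert v V) = Suc (Suc k)"
      using V uv by simp
    ultimately show ?case by blast
  qed
  moreover have "Suc (CARD('n) - 1) = CARD('n)" by simp
  ultimately obtain V F where ok: "ok V F" and V: "card V = CARD('n)"
    by (metis order_refl)
  from V have "V = UNIV" by (simp add: card_eq_UNIV_imp_eq_UNIV)
  show thesis
  proof (rule that[of F])
    have "reachable F r z" for z
      using ok \<open>V = UNIV\<close> by (simp add: ok_def)
    then show "graph_connected F"
      by (rule graph_connectedI)
  qed (use ok \<open>V = UNIV\<close> in \<open>auto simp: ok_def\<close>)
qed

lemma spanning_tree_exists:
  fixes E :: "'n::finite set set"
  assumes "graph_connected E"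
  shows "\<exists>F\<subseteq>E. graph_connected F \<and> card F + 1 = CARD('n)"
proof (rule grow_spanning_tree[OF assms, of "\<lambda>_ _. True"])
  fix F assume "F \<subseteq> E" "graph_connected F" "card F + 1 = CARD('n)"
  then show ?thesis by blast
qed simp_all

lemma graph_connected_card_ge:
  fixes E :: "'n::finite set set"
  assumes "graph_connected E"
  shows "CARD('n) \<le> card E + 1"
proof -
  obtain F where "F \<subseteq> E" "card F + 1 = CARD('n)"
    using spanning_tree_exists[OF assms] by blast
  then show ?thesis using card_mono[of E F] by simp
qed

text \<open>
  Otherwise the link could be dropped, leaving a connected graph with fewer than \<open>n - 1\<close> links.
\<close>

lemma minimal_connected_bridge:
  fixes T :: "'n::finite set set"
  assumes "graph_connected T" and "card T + 1 = CARD('n)" and "{x, y} \<in> T"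
  shows "\<not> reachable (T - {{x, y}}) x y"
proof
  assume "reachable (T - {{x, y}}) x y"
  then have "CARD('n) \<le> card (T - {{x, y}}) + 1"
    by (intro graph_connected_card_ge graph_connected_remove_link assms)
  moreover have "card T > 0" using assms(3) by (auto simp: card_gt_0_iff)
  ultimately show False
    using assms by simp
qed

text \<open>
  Replacing the absence of cycles by a count makes the exchange of one link of a tree for another
  a matter of connectedness alone. If \<open>E\<close> is acyclic, a link of \<open>E\<close> outside a spanning tree
  \<open>F \<subseteq> E\<close> would close the simple path of \<open>F\<close> between its ends to a cycle; conversely a link on a
  cycle is not a bridge.
\<close>

lemma is_tree_iff_card:
  fixes E :: "'n::finite set set"
  assumes "\<forall>e\<in>E. card e = 2"
  shows "is_tree E \<longleftrightarrow> graph_connected E \<and> card E + 1 = CARD('n)"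
proof
  assume tree: "is_tree E"
  then have conn: "graph_connected E" by (simp add: is_tree_def)
  obtain F where F: "F \<subseteq> E" "graph_connected F" "card F + 1 = CARD('n)"
    using spanning_tree_exists[OF conn] by blast
  have "E \<subseteq> F"
  proof
    fix e assume "e \<in> E"
    then obtain x y where e: "e = {x, y}" "x \<noteq> y"
      using assms by (metis card_2_iff)
    show "e \<in> F"
    proof (rule ccontr)
      assume "e \<notin> F"
      obtain vs where vs: "vs \<noteq> []" "distinct vs" "hd vs = x" "last vs = y"
        "\<And>k. Suc k < length vs \<Longrightarrow> {vs ! k, vs ! Suc k} \<in> F"
        using F(2) reachable_imp_simple_path unfolding graph_connected_iff_reachable by metis
      have "length vs \<noteq> 1"
        using vs e by (auto simp: length_Suc_conv)
      moreover have "length vs \<noteq> 2"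
        using vs(1-4) vs(5)[of 0] e \<open>e \<notin> F\<close> by (auto simp: numeral_2_eq_2 length_Suc_conv)
      moreover have "length vs \<noteq> 0" using vs by simp
      ultimately have "length vs \<ge> 3" by linarith
      then have "is_cycle E vs"
        using vs F(1) \<open>e \<in> E\<close> e by (auto simp: is_cycle_def insert_commute)
      then show False using tree by (auto simp: is_tree_def)
    qed
  qed
  then show "graph_connected E \<and> card E + 1 = CARD('n)"
    using F by auto
next
  assume E: "graph_connected E \<and> card E + 1 = CARD('n)"
  have "\<not> is_cycle E vs" for vs
  proof
    assume cyc: "is_cycle E vs"
    then have len: "length vs \<ge> 3" and dist: "distinct vs" by (auto simp: is_cycle_def)
    have "vs \<noteq> []" using len by auto
    then have ends: "hd vs = vs ! 0" "last vs = vs ! (length vs - 1)"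
      by (simp_all add: hd_conv_nth last_conv_nth)
    let ?F = "E - {{last vs, hd vs}}"
    have "reachable ?F (hd vs) (vs ! k)" if "k < length vs" for k
      using that
    proof (induction k)
      case 0
      then show ?case using ends by simp
    next
      case (Suc k)
      have "vs ! k = vs ! 0 \<longleftrightarrow> k = 0" "vs ! Suc k \<noteq> vs ! 0"
        "vs ! Suc k = vs ! (length vs - 1) \<longleftrightarrow> Suc k = length vs - 1"
        using Suc.prems dist \<open>vs \<noteq> []\<close> by (simp_all add: nth_eq_iff_index_eq)
      moreover have "\<not> (k = 0 \<and> Suc k = length vs - 1)"
        using len by linarith
      ultimately have "{vs ! k, vs ! Suc k} \<noteq> {last vs, hd vs}"
        unfolding ends doubleton_eq_iff by blast
      then have "{vs ! k, vs ! Suc k} \<in> ?F"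
        using cyc Suc.prems by (auto simp: is_cycle_def)
      then show ?case
        using Suc by (meson Suc_lessD reachable_link reachable_trans)
    qed
    from this[of "length vs - 1"] have "reachable ?F (hd vs) (last vs)"
      using \<open>vs \<noteq> []\<close> ends by simp
    then have "reachable ?F (last vs) (hd vs)"
      by (rule reachable_sym)
    then show False
      using minimal_connected_bridge[of E "last vs" "hd vs"] E cyc by (auto simp: is_cycle_def)
  qed
  then show "is_tree E" using E by (auto simp: is_tree_def)
qed

lemma spanning_trees_iff:
  fixes L :: "'n::finite set set"
  assumes "weighted_graph L c"
  shows "T \<in> spanning_trees L \<longleftrightarrow> T \<subseteq> L \<and> graph_connected T \<and> card T + 1 = CARD('n)"
proof (cases "T \<subseteq> L")
  case True
  then have "\<forall>e\<in>T. card e = 2"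
    using assms by (auto simp: weighted_graph_def)
  with True show ?thesis
    by (simp add: spanning_trees_def is_tree_iff_card)
qed (simp add: spanning_trees_def)


section \<open>A plane tree has no bounded face\<close>

text \<open>
  Grow the tree link by link. A new arc meets the part drawn so far only in the node at which it is
  attached, a connected set, and neither the old part nor an arc separates the plane; by
  Janiszewski's theorem their union does not separate it either.
\<close>

lemma tree_complement_connected:
  fixes T :: "'n::finite set set"
  assumes T: "graph_connected T" "card T + 1 = CARD('n)" and emb: "plane_embedding T \<phi> \<gamma>"
  defines "K \<equiv> range \<phi> \<union> (\<Union>e\<in>T. path_image (\<gamma> e))"
  shows "compact K" and "connected (- K)"
proof -
  define drawing where "drawing V F = \<phi> ` V \<union> (\<Union>e\<in>F. path_image (\<gamma> e))" for V F
  define P where "P V F \<longleftrightarrow> compact (drawing V F) \<and> connected (- drawing V F)" for V F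
  obtain F where F: "F \<subseteq> T" "card F + 1 = CARD('n)" "P UNIV F"
  proof (rule grow_spanning_tree[OF T(1), of P undefined])
    show "P {undefined} {}"
      by (simp add: P_def drawing_def connected_punctured_universe)
  next
    fix V F u v
    assume IH: "P V F" and F: "F \<subseteq> T" "\<Union>F \<subseteq> V" and uv: "u \<in> V" "v \<notin> V" "{u, v} \<in> T"
    let ?A = "path_image (\<gamma> {u, v})"
    have arc: "arc (\<gamma> {u, v})"
      and nodes: "?A \<inter> range \<phi> = {\<phi> u, \<phi> v}"
      using emb uv by (simp_all add: plane_embedding_def)
    have "inj \<phi>" using emb by (simp add: plane_embedding_def)
    have mem: "\<phi> u \<in> ?A" "\<phi> v \<in> ?A" using nodes by auto
    have "?A \<inter> \<phi> ` V = {\<phi> u}"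
    proof -
      have "?A \<inter> \<phi> ` V = (?A \<inter> range \<phi>) \<inter> \<phi> ` V" by blast
      then show ?thesis
        unfolding nodes using uv \<open>inj \<phi>\<close> by (auto simp: inj_eq)
    qed
    moreover have "?A \<inter> path_image (\<gamma> e) \<subseteq> {\<phi> u}" if "e \<in> F" for e
    proof -
      have "v \<notin> e" using that F uv by auto
      then have "{u, v} \<noteq> e" by auto
      moreover have "e \<in> T" using that F by blast
      ultimately have "?A \<inter> path_image (\<gamma> e) = \<phi> ` ({u, v} \<inter> e)"
        using emb uv by (simp add: plane_embedding_def)
      then show ?thesis using \<open>v \<notin> e\<close> by auto
    qed
    ultimately have meet: "drawing V F \<inter> ?A = {\<phi> u}"
      unfolding drawing_def by blast
    have "connected (- (drawing V F \<union> ?A))"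
    proof (rule Janiszewski_connected)
      show "compact (drawing V F)" "connected (- drawing V F)"
        using IH by (simp_all add: P_def)
      show "closed ?A" using arc by (simp add: closed_arc_image)
      show "connected (drawing V F \<inter> ?A)" unfolding meet by simp
      show "connected (- ?A)" using arc by (simp add: connected_arc_complement)
    qed
    moreover have "compact (drawing V F \<union> ?A)"
      using IH arc by (simp add: P_def compact_Un compact_arc_image)
    moreover have "drawing (insert v V) (insert {u, v} F) = drawing V F \<union> ?A"
      using mem by (auto simp: drawing_def)
    ultimately show "P (insert v V) (insert {u, v} F)"
      by (simp add: P_def)
  qed
  have "F = T"
    using F T(2) by (intro card_subset_eq) simp_all
  then show "compact K" "connected (- K)"
    using F by (simp_all add: P_def drawing_def K_def)
qed

text \<open>
  The only face is the complement of a compact set, hence unbounded, and a tree does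
  not count its unbounded face: the sum over faces is empty.
\<close>

lemma combinatorial_curvature_tree:
  fixes T :: "'n::finite set set"
  assumes tree: "is_tree T" and links: "\<forall>e\<in>T. card e = 2" and emb: "plane_embedding T \<phi> \<gamma>"
  shows "combinatorial_curvature T \<phi> \<gamma> i = 1 - degree T i / 2"
proof -
  let ?K = "range \<phi> \<union> (\<Union>e\<in>T. path_image (\<gamma> e))"
  have T: "graph_connected T" "card T + 1 = CARD('n)"
    using is_tree_iff_card[OF links] tree by auto
  have "\<not> bounded f" if "f \<in> faces T \<phi> \<gamma>" for f
  proof -
    have "components (- ?K) \<subseteq> {- ?K}"
      using tree_complement_connected(2)[OF T emb] by (simp add: connected_eq_components_subset_sing)
    then have "f = - ?K"
      using that unfolding faces_def by blast
    then have "- f = ?K" by simp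
    then have "bounded (- f)"
      using compact_imp_bounded[OF tree_complement_connected(1)[OF T emb]] by simp
    then show ?thesis by (rule cobounded_imp_unbounded)
  qed
  then have "{f. f \<in> faces T \<phi> \<gamma> \<and> \<phi> i \<in> frontier f \<and> \<not> (is_tree T \<and> \<not> bounded f)} = {}"
    using tree by blast
  then show ?thesis
    unfolding combinatorial_curvature_def by (simp only: sum.empty)
qed


section \<open>Effective resistance from a potential\<close>

lemma moore_penrose_inverse_unique:
  assumes X: "is_moore_penrose_inverse A X" and Y: "is_moore_penrose_inverse A Y"
  shows "X = Y"
proof -
  have AX: "A ** X = A ** Y"
  proof -
    have "A ** X = (A ** Y) ** (A ** X)"
      using Y by (metis is_moore_penrose_inverse_def matrix_mul_assoc)
    also have "\<dots> = transpose (A ** Y) ** transpose (A ** X)"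
      using X Y by (simp add: is_moore_penrose_inverse_def)
    also have "\<dots> = transpose ((A ** X ** A) ** Y)"
      by (metis matrix_mul_assoc matrix_transpose_mul)
    also have "\<dots> = A ** Y"
      using X Y by (simp add: is_moore_penrose_inverse_def)
    finally show ?thesis .
  qed
  have XA: "X ** A = Y ** A"
  proof -
    have "X ** A = (X ** A) ** (Y ** A)"
      using Y by (metis is_moore_penrose_inverse_def matrix_mul_assoc)
    also have "\<dots> = transpose (X ** A) ** transpose (Y ** A)"
      using X Y by (simp add: is_moore_penrose_inverse_def)
    also have "\<dots> = transpose (Y ** (A ** X ** A))"
      by (metis matrix_mul_assoc matrix_transpose_mul)
    also have "\<dots> = Y ** A"
      using X Y by (simp add: is_moore_penrose_inverse_def)
    finally show ?thesis .
  qed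
  have "X = X ** (A ** X)"
    using X by (simp add: is_moore_penrose_inverse_def matrix_mul_assoc)
  also have "\<dots> = (X ** A) ** Y"
    by (simp add: AX matrix_mul_assoc)
  also have "\<dots> = Y"
    using Y by (simp add: XA is_moore_penrose_inverse_def)
  finally show ?thesis .
qed

text \<open>
  \<open>P\<close> plays the role of the orthogonal projection onto the range of \<open>A\<close>: a symmetric
  right identity of \<open>A\<close> all of whose columns lie in the range of \<open>A\<close> (witnessed by \<open>G\<close>).
\<close>

lemma symmetric_moore_penrose_inverse:
  fixes A P G :: "real^'n^'n"
  assumes A: "transpose A = A" and P: "transpose P = P" and AP: "A ** P = A" and AG: "A ** G = P"
  shows "is_moore_penrose_inverse A (P ** G)"
proof -
  let ?X = "P ** G"
  have PA: "P ** A = A"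
    using A P AP by (metis matrix_transpose_mul)
  have AX: "A ** ?X = P"
    using AP AG by (simp add: matrix_mul_assoc)
  have "P ** P = P"
    using PA AG by (metis matrix_mul_assoc)
  then have PX: "P ** ?X = ?X"
    by (simp add: matrix_mul_assoc)
  have XA': "transpose ?X ** A = P"
    using AX A P by (metis matrix_transpose_mul)
  have "?X = transpose ?X ** P"
    using PX XA' AX by (metis matrix_mul_assoc)
  also have "\<dots> = transpose ?X"
    using PX P by (metis matrix_transpose_mul)
  finally have XA: "?X ** A = P"
    using XA' by simp
  show ?thesis
    unfolding is_moore_penrose_inverse_def AX XA using PA PX P by simp
qed

lemma laplacian_mult:
  assumes "weighted_graph L c"
  shows "(laplacian L c *v v) $ x = (\<Sum>y | {x, y} \<in> L. c {x, y} * (v $ x - v $ y))"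
proof -
  have "{x, x} \<notin> L"
    using assms by (auto simp: weighted_graph_def)
  have "(laplacian L c *v v) $ x =
    (\<Sum>y\<in>UNIV. (if x = y then (\<Sum>k | {x, k} \<in> L. c {x, k}) * v $ x else 0) -
       (if {x, y} \<in> L then c {x, y} * v $ y else 0))"
    unfolding matrix_vector_mult_def laplacian_def
    using \<open>{x, x} \<notin> L\<close> by (auto intro!: sum.cong)
  also have "\<dots> = (\<Sum>k | {x, k} \<in> L. c {x, k}) * v $ x - (\<Sum>y | {x, y} \<in> L. c {x, y} * v $ y)"
    by (simp add: sum_subtractf sum.inter_filter[symmetric])
  also have "\<dots> = (\<Sum>y | {x, y} \<in> L. c {x, y} * (v $ x - v $ y))"
    by (simp add: sum_distrib_right right_diff_distrib sum_subtractf)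
  finally show ?thesis .
qed

lemma transpose_laplacian: "transpose (laplacian L c) = laplacian L c"
  by (simp add: laplacian_def transpose_def vec_eq_iff insert_commute eq_commute)

text \<open>
  The columns of the centring projection \<open>P = I - J/n\<close>, with \<open>J\<close> the all-ones matrix, are averages
  of the differences \<open>e\<^sub>a - e\<^sub>b\<close>, and \<open>Q P = Q\<close> because the rows of \<open>Q\<close> sum to zero. So solving
  \<open>Q v = e\<^sub>a - e\<^sub>b\<close> for all pairs yields the pseudoinverse, and with its uniqueness the
  description operator in its definition is meaningful.
\<close>

lemma laplacian_moore_penrose_inverse:
  fixes L :: "'n::finite set set"
  assumes graph: "weighted_graph L c"
    and solvable: "\<And>a b. \<exists>v. laplacian L c *v v = axis a 1 - axis b 1"
  shows "is_moore_penrose_inverse (laplacian L c) (moore_penrose_inverse (laplacian L c))"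
proof -
  define N where "N = real CARD('n)"
  have "N \<noteq> 0" by (simp add: N_def)
  define P :: "real^'n^'n" where "P = mat 1 - (\<chi> i j. 1 / N)"
  let ?Q = "laplacian L c"
  obtain v where v: "\<And>a b. ?Q *v v a b = axis a 1 - axis b 1"
    using solvable by metis
  define G :: "real^'n^'n" where "G = (\<chi> k a. (\<Sum>b\<in>UNIV. v a b $ k) / N)"
  have "?Q *v (\<chi> k. 1 / N) = 0"
    by (simp add: vec_eq_iff laplacian_mult[OF graph])
  then have "?Q ** (\<chi> i j. 1 / N) = (0 :: real^'n^'n)"
    by (simp add: vec_eq_iff matrix_matrix_mult_def matrix_vector_mult_def)
  moreover have "?Q ** P = ?Q ** mat 1 - ?Q ** (\<chi> i j. 1 / N)"
    by (simp add: P_def vec_eq_iff matrix_matrix_mult_def right_diff_distrib sum_subtractf)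
  ultimately have "?Q ** P = ?Q" by simp
  moreover have "transpose P = P"
    by (auto simp: P_def transpose_def mat_def vec_eq_iff)
  moreover have "?Q ** G = P"
  proof -
    have "(?Q ** G) $ i $ a = P $ i $ a" for i a
    proof -
      have "(?Q ** G) $ i $ a = (\<Sum>k\<in>UNIV. \<Sum>b\<in>UNIV. ?Q $ i $ k * v a b $ k) / N"
        by (simp add: matrix_matrix_mult_def G_def sum_distrib_left sum_divide_distrib)
      also have "\<dots> = (\<Sum>b\<in>UNIV. (?Q *v v a b) $ i) / N"
        by (subst sum.swap) (simp add: matrix_vector_mult_def)
      also have "\<dots> = (N * (if i = a then 1 else 0) - 1) / N"
        by (simp add: v axis_def sum_subtractf N_def eq_commute)
      also have "\<dots> = P $ i $ a"
        using \<open>N \<noteq> 0\<close> by (simp add: P_def mat_def diff_divide_distrib)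
      finally show ?thesis .
    qed
    then show ?thesis by (simp add: vec_eq_iff)
  qed
  ultimately have PG: "is_moore_penrose_inverse ?Q (P ** G)"
    by (intro symmetric_moore_penrose_inverse transpose_laplacian)
  show ?thesis
    unfolding moore_penrose_inverse_def
  proof (rule theI)
    show "is_moore_penrose_inverse ?Q (P ** G)" by (rule PG)
    show "X = P ** G" if "is_moore_penrose_inverse ?Q X" for X
      using that PG by (rule moore_penrose_inverse_unique)
  qed
qed

text \<open>
  If \<open>Q v = e\<^sub>a - e\<^sub>b\<close>, then \<open>\<omega>\<^sub>a\<^sub>b = (Q v)\<^sup>T Q\<^sup>\<dagger> (Q v) = v\<^sup>T Q Q\<^sup>\<dagger> Q v = v\<^sup>T Q v\<close>:
  any potential driving a unit current from \<open>a\<close> to \<open>b\<close> computes the resistance.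
\<close>

lemma effective_resistance_potential:
  fixes L :: "'n::finite set set"
  assumes "weighted_graph L c"
    and "\<And>a b. \<exists>v. laplacian L c *v v = axis a 1 - axis b 1"
    and v: "laplacian L c *v v = axis a 1 - axis b 1"
  shows "effective_resistance L c a b = v $ a - v $ b"
proof -
  let ?Q = "laplacian L c"
  let ?X = "moore_penrose_inverse ?Q"
  have "?Q ** ?X ** ?Q = ?Q"
    using laplacian_moore_penrose_inverse[OF assms(1,2)] by (simp add: is_moore_penrose_inverse_def)
  then have "?Q *v (?X *v (?Q *v v)) = ?Q *v v"
    by (simp add: matrix_vector_mul_assoc matrix_mul_assoc)
  then have "(?Q *v v) \<bullet> (?X *v (?Q *v v)) = v \<bullet> (?Q *v v)"
    by (metis dot_lmul_matrix transpose_laplacian transpose_matrix_vector)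
  then show ?thesis
    unfolding effective_resistance_def v[symmetric] unfolding v
    by (simp add: inner_diff_right inner_axis)
qed


section \<open>Kirchhoff potentials from two-component forests\<close>

lemma neighbour_towards_exists:
  assumes "graph_connected T" and "b \<noteq> x"
  shows "\<exists>y. {x, y} \<in> T \<and> reachable (T - {{x, y}}) b y"
proof -
  let ?R = "{e \<in> T. x \<notin> e}"
  \<comment> \<open>Walk from \<open>b\<close> until the node before the first visit to \<open>x\<close>.\<close>
  have "reachable ?R b z \<and> z \<noteq> x \<or> (\<exists>y. {x, y} \<in> T \<and> reachable ?R b y)" if "reachable T b z" for z
    using that
  proof (induction rule: reachable_induct)
    case refl
    show ?case using \<open>b \<noteq> x\<close> by simp
  next
    case (step u z)
    show ?case
    proof (cases "\<exists>y. {x, y} \<in> T \<and> reachable ?R b y")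
      case False
      then have u: "reachable ?R b u" "u \<noteq> x" using step.IH by auto
      then have "z \<noteq> x" using step.hyps False by (auto simp: insert_commute)
      then have "{u, z} \<in> ?R" using step.hyps u by simp
      then have "reachable ?R b z" by (rule reachable_trans[OF u(1) reachable_link])
      then show ?thesis using \<open>z \<noteq> x\<close> by simp
    qed simp
  qed
  moreover have "reachable T b x" using assms(1) by (simp add: graph_connected_iff_reachable)
  ultimately obtain y where y: "{x, y} \<in> T" "reachable ?R b y" by blast
  have "reachable (T - {{x, y}}) b y"
    by (rule reachable_mono[OF y(2)]) auto
  with y(1) show ?thesis by blast
qed

text \<open>
  Let \<open>R\<close> be \<open>T\<close> without the two links. In \<open>T\<close> minus one link, the walk from \<open>b\<close> cannot use the
  other one without passing through \<open>x\<close>, which would make the removed link superfluous. So both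
  walks stay inside \<open>R\<close>, where \<open>y\<close> and \<open>z\<close> would then be connected: again a link is superfluous.
\<close>

lemma neighbour_towards_unique:
  fixes T :: "'n::finite set set"
  assumes T: "graph_connected T" "card T + 1 = CARD('n)"
    and y: "{x, y} \<in> T" "reachable (T - {{x, y}}) b y"
    and z: "{x, z} \<in> T" "reachable (T - {{x, z}}) b z"
  shows "y = z"
proof (rule ccontr)
  assume "y \<noteq> z"
  then have ne: "{x, y} \<noteq> {x, z}" by (auto simp: doubleton_eq_iff)
  let ?R = "T - {{x, y}, {x, z}}"
  have xy: "T - {{x, y}} = insert {x, z} ?R" and xz: "T - {{x, z}} = insert {x, y} ?R"
    using ne y(1) z(1) by auto
  have no_xy: "\<not> reachable (insert {x, z} ?R) x y" and no_xz: "\<not> reachable (insert {x, y} ?R) x z"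
    using minimal_connected_bridge[OF T] y(1) z(1) unfolding xy[symmetric] xz[symmetric] by auto
  have sub: "reachable (insert e ?R) p q" if "reachable ?R p q" for e p q
    using that by (rule reachable_mono) auto
  have no: "\<not> reachable ?R x y" "\<not> reachable ?R x z" "\<not> reachable ?R z y" "\<not> reachable ?R y z"
    using no_xy no_xz sub reachable_trans[OF reachable_link[of x z "insert {x, z} ?R"]]
      reachable_trans[OF reachable_link[of x y "insert {x, y} ?R"]] by auto
  have "reachable ?R b y"
    using reachable_insertD[OF y(2)[unfolded xy]] no by auto
  moreover have "reachable ?R b z"
    using reachable_insertD[OF z(2)[unfolded xz]] no by auto
  ultimately have "reachable ?R z y"
    by (rule reachable_join[rotated])
  with no(3) show False by simp
qed

text \<open>
  Exactly one link at \<open>x\<close> leads towards \<open>b\<close>, unless \<open>x = b\<close>. Subtracting this for two targets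
  \<open>a\<close>, \<open>b\<close> is the conservation law for the unit flow from \<open>a\<close> to \<open>b\<close> along the path in \<open>T\<close>.
\<close>

lemma sum_neighbours_towards:
  fixes T :: "'n::finite set set"
  assumes T: "graph_connected T" "card T + 1 = CARD('n)"
  shows "(\<Sum>y | {x, y} \<in> T. of_bool (reachable (T - {{x, y}}) b y)) = (of_bool (b \<noteq> x) :: real)"
proof (cases "b = x")
  case True
  then show ?thesis
    using minimal_connected_bridge[OF T] by (auto intro!: sum.neutral)
next
  case False
  obtain y where y: "{x, y} \<in> T" "reachable (T - {{x, y}}) b y"
    using neighbour_towards_exists[OF T(1) False] by blast
  have "(\<Sum>z | {x, z} \<in> T. of_bool (reachable (T - {{x, z}}) b z)) =
      (\<Sum>z | {x, z} \<in> T. if z = y then 1 else 0 :: real)"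
  proof (rule sum.cong[OF refl])
    fix z assume "z \<in> {z. {x, z} \<in> T}"
    then have "reachable (T - {{x, z}}) b z \<longleftrightarrow> z = y"
      using neighbour_towards_unique[OF T y, of z] y(2) by blast
    then show "of_bool (reachable (T - {{x, z}}) b z) = (if z = y then 1 else 0 :: real)" by simp
  qed
  also have "\<dots> = 1" using y by simp
  finally show ?thesis using False by simp
qed

text \<open>
  The spanning forests with two components, one around \<open>a\<close> and one around \<open>b\<close>. Acyclicity and the
  separation of \<open>a\<close> from \<open>b\<close> are consequences of the number of links.
\<close>

definition two_forests :: "'n::finite set set \<Rightarrow> 'n \<Rightarrow> 'n \<Rightarrow> 'n set set set" where
  "two_forests L a b =
     {F. F \<subseteq> L \<and> card F + 2 = CARD('n) \<and> (\<forall>z. reachable F a z \<or> reachable F b z)}"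

lemma two_forest_separates:
  assumes "F \<in> two_forests L a b"
  shows "\<not> (reachable F a z \<and> reachable F b z)"
proof
  assume "reachable F a z \<and> reachable F b z"
  then have "reachable F a b"
    using reachable_trans[of F a z b] reachable_sym[of F b z] by blast
  then have "reachable F a u" for u
    using assms reachable_trans[of F a b u] by (auto simp: two_forests_def)
  then have "graph_connected F" by (rule graph_connectedI)
  from graph_connected_card_ge[OF this] show False
    using assms by (simp add: two_forests_def)
qed

lemma insert_link_two_forest:
  fixes L :: "'n::finite set set"
  assumes F: "F \<in> two_forests L a b" and "{x, y} \<in> L" and x: "reachable F a x" and y: "reachable F b y"
  shows "{x, y} \<notin> F" and "insert {x, y} F \<subseteq> L" and "graph_connected (insert {x, y} F)"
    and "card (insert {x, y} F) + 1 = CARD('n)"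
proof -
  show new: "{x, y} \<notin> F"
    using two_forest_separates[OF F, of y] y reachable_trans[OF x reachable_link] by blast
  show "insert {x, y} F \<subseteq> L"
    using F assms(2) by (simp add: two_forests_def)
  show "card (insert {x, y} F) + 1 = CARD('n)"
    using F new by (simp add: two_forests_def)
  let ?T = "insert {x, y} F"
  have sub: "reachable ?T u v" if "reachable F u v" for u v
    using that by (rule reachable_mono) auto
  have "reachable ?T a b"
    by (rule reachable_trans[OF sub[OF x] reachable_trans[OF _ sub[OF reachable_sym[OF y]]]])
      (simp add: reachable_link)
  then have "reachable ?T a z" for z
    using F sub[of a z] sub[of b z] reachable_trans[of ?T a b z] by (auto simp: two_forests_def)
  then show "graph_connected ?T" by (rule graph_connectedI)
qed

lemma remove_link_two_forest:
  fixes L :: "'n::finite set set"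
  assumes "T \<subseteq> L" and T: "graph_connected T" "card T + 1 = CARD('n)" and "{x, y} \<in> T"
    and a: "reachable (T - {{x, y}}) a x" and b: "reachable (T - {{x, y}}) b y"
  shows "T - {{x, y}} \<in> two_forests L a b"
proof -
  have "card T > 0" using assms(4) by (auto simp: card_gt_0_iff)
  then have "card (T - {{x, y}}) + 2 = CARD('n)"
    using T(2) assms(4) by simp
  moreover have "reachable (T - {{x, y}}) a z \<or> reachable (T - {{x, y}}) b z" for z
    using reachable_one_end_of_removed_link[OF T(1) assms(4), of z]
      reachable_trans[OF a reachable_sym] reachable_trans[OF b reachable_sym] by blast
  ultimately show ?thesis
    using assms(1) by (auto simp: two_forests_def)
qed

text \<open>
  The bijection \<open>F \<mapsto> F \<union> {{x, y}}\<close>: the trees on the right are those whose path from \<open>a\<close> to \<open>b\<close>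
  runs through the link from \<open>x\<close> to \<open>y\<close>.
\<close>

lemma sum_two_forests_eq_sum_trees:
  fixes L :: "'n::finite set set"
  assumes graph: "weighted_graph L c" and "{x, y} \<in> L"
  shows "c {x, y} * (\<Sum>F | F \<in> two_forests L a b \<and> reachable F a x \<and> reachable F b y. tree_weight c F) =
    (\<Sum>T | T \<in> spanning_trees L \<and> {x, y} \<in> T \<and>
        reachable (T - {{x, y}}) a x \<and> reachable (T - {{x, y}}) b y. tree_weight c T)"
  unfolding sum_distrib_left
proof (rule sum.reindex_bij_witness[where i = "\<lambda>T. T - {{x, y}}" and j = "insert {x, y}"], goal_cases)
  case (1 F)
  then show ?case using insert_link_two_forest[of F L a b x y] assms(2) by auto
next
  case (2 F)
  then show ?case
    using insert_link_two_forest[of F L a b x y] assms(2) by (auto simp: spanning_trees_iff[OF graph])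
next
  case (3 T)
  then show ?case by auto
next
  case (4 T)
  then show ?case
    using remove_link_two_forest[of T L x y a b] by (auto simp: spanning_trees_iff[OF graph])
next
  case (5 F)
  then show ?case
    using insert_link_two_forest[of F L a b x y] assms(2) by (simp add: tree_weight_def)
qed

text \<open>
  Up to the factor \<open>\<Sum>\<^sub>T c(T)\<close>, this is the potential of a unit current from \<open>a\<close> to \<open>b\<close>,
  normalised to vanish at \<open>b\<close>.
\<close>

definition forest_potential :: "'n::finite set set \<Rightarrow> ('n set \<Rightarrow> real) \<Rightarrow> 'n \<Rightarrow> 'n \<Rightarrow> real^'n" where
  "forest_potential L c a b =
     (\<chi> x. \<Sum>F | F \<in> two_forests L a b \<and> reachable F a x. tree_weight c F)"

text \<open>
  Ohm's law: the current through the link is the flow of the tree paths from \<open>a\<close> to \<open>b\<close>, summed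
  over all trees with their weights. Forests with \<open>x\<close> and \<open>y\<close> in the same component cancel, and
  the others turn into trees by adding the link. The bracket on the right is \<open>1\<close> if the path of
  \<open>T\<close> traverses the link from \<open>x\<close> to \<open>y\<close>, \<open>-1\<close> if from \<open>y\<close> to \<open>x\<close>, and \<open>0\<close> otherwise.
\<close>

lemma forest_potential_drop:
  fixes L :: "'n::finite set set"
  assumes graph: "weighted_graph L c" and xy: "{x, y} \<in> L"
  shows "c {x, y} * (forest_potential L c a b $ x - forest_potential L c a b $ y) =
    (\<Sum>T | T \<in> spanning_trees L \<and> {x, y} \<in> T. tree_weight c T *
       (of_bool (reachable (T - {{x, y}}) b y) - of_bool (reachable (T - {{x, y}}) a y)))"
proof -
  let ?S = "\<lambda>u v. \<Sum>F | F \<in> two_forests L a b \<and> reachable F a u \<and> reachable F b v. tree_weight c F"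
  let ?N = "\<lambda>u v. \<Sum>T | T \<in> spanning_trees L \<and> {u, v} \<in> T \<and>
        reachable (T - {{u, v}}) a u \<and> reachable (T - {{u, v}}) b v. tree_weight c T"
  have xy': "{y, x} \<in> L" using xy by (simp add: insert_commute)
  have split: "forest_potential L c a b $ u = ?S u v + 
      (\<Sum>F | F \<in> two_forests L a b \<and> reachable F a u \<and> reachable F a v. tree_weight c F)" for u v
  proof -
    have "{F. F \<in> two_forests L a b \<and> reachable F a u} =
      {F. F \<in> two_forests L a b \<and> reachable F a u \<and> reachable F b v} \<union>
      {F. F \<in> two_forests L a b \<and> reachable F a u \<and> reachable F a v}"
      by (auto simp: two_forests_def)
    then show ?thesis
      unfolding forest_potential_def using two_forest_separates[of _ L a b v]
      by (simp, intro sum.union_disjoint) auto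
  qed
  have "forest_potential L c a b $ x - forest_potential L c a b $ y = ?S x y - ?S y x"
    using split[of x y] split[of y x] by (simp add: conj_ac)
  then have "c {x, y} * (forest_potential L c a b $ x - forest_potential L c a b $ y) =
      c {x, y} * ?S x y - c {y, x} * ?S y x"
    by (simp add: right_diff_distrib insert_commute)
  also have "\<dots> = ?N x y - ?N y x"
    using sum_two_forests_eq_sum_trees[OF graph xy, of a b]
      sum_two_forests_eq_sum_trees[OF graph xy', of a b] by simp
  also have "\<dots> = (\<Sum>T | T \<in> spanning_trees L \<and> {x, y} \<in> T. tree_weight c T *
      (of_bool (reachable (T - {{x, y}}) a x \<and> reachable (T - {{x, y}}) b y) -
       of_bool (reachable (T - {{x, y}}) a y \<and> reachable (T - {{x, y}}) b x)))"
  proof -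
    have N: "?N u v = (\<Sum>T | T \<in> spanning_trees L \<and> {u, v} \<in> T. tree_weight c T *
        of_bool (reachable (T - {{u, v}}) a u \<and> reachable (T - {{u, v}}) b v))" for u v
      by (rule sum.mono_neutral_cong_left) auto
    have "?N y x = (\<Sum>T | T \<in> spanning_trees L \<and> {x, y} \<in> T. tree_weight c T *
        of_bool (reachable (T - {{x, y}}) a y \<and> reachable (T - {{x, y}}) b x))"
      unfolding N by (simp only: insert_commute)
    then show ?thesis
      unfolding N[of x y] by (simp only: sum_subtractf[symmetric] right_diff_distrib)
  qed
  also have "\<dots> = (\<Sum>T | T \<in> spanning_trees L \<and> {x, y} \<in> T. tree_weight c T *
       (of_bool (reachable (T - {{x, y}}) b y) - of_bool (reachable (T - {{x, y}}) a y)))"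
  proof (rule sum.cong[OF refl])
    fix T assume "T \<in> {T. T \<in> spanning_trees L \<and> {x, y} \<in> T}"
    then have T: "graph_connected T" "card T + 1 = CARD('n)" and "{x, y} \<in> T"
      by (auto simp: spanning_trees_iff[OF graph])
    have either: "reachable (T - {{x, y}}) z x \<longleftrightarrow> \<not> reachable (T - {{x, y}}) z y" for z
      using reachable_one_end_of_removed_link[OF T(1) \<open>{x, y} \<in> T\<close>, of z]
        minimal_connected_bridge[OF T \<open>{x, y} \<in> T\<close>] reachable_join[of _ z x y] by blast
    show "tree_weight c T *
      (of_bool (reachable (T - {{x, y}}) a x \<and> reachable (T - {{x, y}}) b y) -
       of_bool (reachable (T - {{x, y}}) a y \<and> reachable (T - {{x, y}}) b x)) = tree_weight c T *
       (of_bool (reachable (T - {{x, y}}) b y) - of_bool (reachable (T - {{x, y}}) a y))"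
      unfolding either[of a] either[of b] by simp
  qed
  finally show ?thesis .
qed

text \<open>
  Kirchhoff's current law: after exchanging the sums over neighbours and trees, each tree
  contributes the divergence of its own path from \<open>a\<close> to \<open>b\<close>.
\<close>

lemma laplacian_forest_potential:
  fixes L :: "'n::finite set set"
  assumes graph: "weighted_graph L c"
  shows "laplacian L c *v forest_potential L c a b =
    (\<Sum>T\<in>spanning_trees L. tree_weight c T) *\<^sub>R (axis a 1 - axis b 1)"
proof -
  have "(laplacian L c *v forest_potential L c a b) $ x =
    ((\<Sum>T\<in>spanning_trees L. tree_weight c T) *\<^sub>R (axis a 1 - axis b 1)) $ x" for x
  proof -
    let ?g = "\<lambda>T y. of_bool (reachable (T - {{x, y}}) b y) - of_bool (reachable (T - {{x, y}}) a y) :: real"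
    have "(laplacian L c *v forest_potential L c a b) $ x =
      (\<Sum>y | {x, y} \<in> L. \<Sum>T | T \<in> spanning_trees L \<and> {x, y} \<in> T. tree_weight c T * ?g T y)"
      by (simp add: laplacian_mult[OF graph] forest_potential_drop[OF graph])
    also have "\<dots> = (\<Sum>T\<in>spanning_trees L. \<Sum>y | {x, y} \<in> L \<and> {x, y} \<in> T. tree_weight c T * ?g T y)"
      using sum.swap_restrict[of "{y. {x, y} \<in> L}" "spanning_trees L"
          "\<lambda>y T. tree_weight c T * ?g T y" "\<lambda>y T. {x, y} \<in> T"] by simp
    also have "\<dots> = (\<Sum>T\<in>spanning_trees L. tree_weight c T * (of_bool (b \<noteq> x) - of_bool (a \<noteq> x)))"
    proof (rule sum.cong[OF refl])
      fix T assume "T \<in> spanning_trees L"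
      then have T: "T \<subseteq> L" "graph_connected T" "card T + 1 = CARD('n)"
        by (auto simp: spanning_trees_iff[OF graph])
      then have "{y. {x, y} \<in> L \<and> {x, y} \<in> T} = {y. {x, y} \<in> T}" by auto
      then show "(\<Sum>y | {x, y} \<in> L \<and> {x, y} \<in> T. tree_weight c T * ?g T y) =
          tree_weight c T * (of_bool (b \<noteq> x) - of_bool (a \<noteq> x))"
        by (simp only: sum_distrib_left[symmetric] sum_subtractf sum_neighbours_towards[OF T(2,3)])
    qed
    also have "\<dots> = ((\<Sum>T\<in>spanning_trees L. tree_weight c T) *\<^sub>R (axis a 1 - axis b 1)) $ x"
      by (simp add: sum_distrib_right axis_def)
    finally show ?thesis .
  qed
  then show ?thesis by (simp add: vec_eq_iff)
qed

lemma sum_tree_weight_pos: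
  fixes L :: "'n::finite set set"
  assumes graph: "weighted_graph L c" and conn: "graph_connected L"
  shows "(\<Sum>T\<in>spanning_trees L. tree_weight c T) > 0"
proof (rule sum_pos)
  show "spanning_trees L \<noteq> {}"
    using spanning_tree_exists[OF conn] by (auto simp: spanning_trees_iff[OF graph])
  show "tree_weight c T > 0" if "T \<in> spanning_trees L" for T
    using that graph unfolding tree_weight_def spanning_trees_def weighted_graph_def
    by (auto intro!: prod_pos)
qed simp

text \<open>
  Kirchhoff's formula: \<open>c\<^sub>i\<^sub>j \<omega>\<^sub>i\<^sub>j\<close> is the probability that the link lies in a random spanning tree,
  because a tree path from \<open>i\<close> to \<open>j\<close> traverses the link exactly if the tree contains it.
\<close>

lemma link_weight_times_resistance:
  fixes L :: "'n::finite set set"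
  assumes graph: "weighted_graph L c" and conn: "graph_connected L" and ij: "{i, j} \<in> L"
  shows "c {i, j} * effective_resistance L c i j =
    (\<Sum>T | T \<in> spanning_trees L \<and> {i, j} \<in> T. tree_weight c T) /
    (\<Sum>T\<in>spanning_trees L. tree_weight c T)"
proof -
  define Z where "Z = (\<Sum>T\<in>spanning_trees L. tree_weight c T)"
  have "Z > 0" unfolding Z_def by (rule sum_tree_weight_pos[OF graph conn])
  have pot: "laplacian L c *v ((1 / Z) *\<^sub>R forest_potential L c a b) = axis a 1 - axis b 1" for a b
    using \<open>Z > 0\<close> by (simp add: matrix_vector_mult_scaleR laplacian_forest_potential[OF graph] Z_def[symmetric])
  have "c {i, j} * effective_resistance L c i j =
      c {i, j} * (forest_potential L c i j $ i - forest_potential L c i j $ j) / Z"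
    using effective_resistance_potential[OF graph exI, OF pot pot, of i j]
    by (simp add: diff_divide_distrib right_diff_distrib)
  also have "c {i, j} * (forest_potential L c i j $ i - forest_potential L c i j $ j) =
      (\<Sum>T | T \<in> spanning_trees L \<and> {i, j} \<in> T. tree_weight c T)"
    unfolding forest_potential_drop[OF graph ij]
    using minimal_connected_bridge by (intro sum.cong) (auto simp: spanning_trees_iff[OF graph])
  finally show ?thesis by (simp add: Z_def)
qed


section \<open>The expected degree\<close>

lemma degree_eq_card_neighbours:
  fixes T :: "'n::finite set set"
  assumes "\<forall>e\<in>T. card e = 2"
  shows "degree T i = card {j. {i, j} \<in> T}"
proof -
  have "\<exists>j. e = {i, j}" if "e \<in> T" "i \<in> e" for e
  proof -
    from that assms obtain u v where "e = {u, v}" by (meson card_2_iff)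
    with that show ?thesis by (auto simp: insert_commute)
  qed
  then have "{e \<in> T. i \<in> e} = (\<lambda>j. {i, j}) ` {j. {i, j} \<in> T}"
    by auto
  moreover have "inj_on (\<lambda>j. {i, j}) {j. {i, j} \<in> T}"
    by (auto simp: inj_on_def doubleton_eq_iff)
  ultimately show ?thesis
    by (simp add: degree_def card_image)
qed

lemma sum_trees_through_links_at:
  fixes L :: "'n::finite set set"
  assumes graph: "weighted_graph L c"
  shows "(\<Sum>j | {i, j} \<in> L. \<Sum>T | T \<in> spanning_trees L \<and> {i, j} \<in> T. tree_weight c T) =
    (\<Sum>T\<in>spanning_trees L. tree_weight c T * degree T i)"
proof -
  have "(\<Sum>j | {i, j} \<in> L. \<Sum>T | T \<in> spanning_trees L \<and> {i, j} \<in> T. tree_weight c T) =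
    (\<Sum>T\<in>spanning_trees L. \<Sum>j | {i, j} \<in> L \<and> {i, j} \<in> T. tree_weight c T)"
    using sum.swap_restrict[of "{j. {i, j} \<in> L}" "spanning_trees L"
        "\<lambda>j T. tree_weight c T" "\<lambda>j T. {i, j} \<in> T"] by simp
  also have "\<dots> = (\<Sum>T\<in>spanning_trees L. tree_weight c T * degree T i)"
  proof (rule sum.cong[OF refl])
    fix T assume "T \<in> spanning_trees L"
    then have "T \<subseteq> L" by (simp add: spanning_trees_def)
    then have "{j. {i, j} \<in> L \<and> {i, j} \<in> T} = {j. {i, j} \<in> T}" by auto
    moreover have "degree T i = card {j. {i, j} \<in> T}"
      using \<open>T \<subseteq> L\<close> graph by (intro degree_eq_card_neighbours) (auto simp: weighted_graph_def)
    ultimately show "(\<Sum>j | {i, j} \<in> L \<and> {i, j} \<in> T. tree_weight c T) = tree_weight c T * degree T i"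
      by simp
  qed
  finally show ?thesis .
qed

lemma expectation_random_spanning_tree:
  fixes L :: "'n::finite set set" and f :: "'n set set \<Rightarrow> real"
  assumes "random_spanning_tree M L c X"
  shows "prob_space.expectation M (\<lambda>w. f (X w)) =
    (\<Sum>T\<in>spanning_trees L. f T * (tree_weight c T / (\<Sum>T'\<in>spanning_trees L. tree_weight c T')))"
proof -
  interpret prob_space M using assms by (simp add: random_spanning_tree_def)
  have X: "X \<in> M \<rightarrow>\<^sub>M count_space (spanning_trees L)"
    using assms by (simp add: random_spanning_tree_def)
  let ?E = "\<lambda>T. {w \<in> space M. X w = T}"
  have E: "?E T \<in> sets M" if "T \<in> spanning_trees L" for T
  proof -
    have "?E T = X -` {T} \<inter> space M" by auto
    then show ?thesis using measurable_sets[OF X, of "{T}"] that by simp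
  qed
  have "expectation (\<lambda>w. f (X w)) =
      expectation (\<lambda>w. \<Sum>T\<in>spanning_trees L. f T * indicator (?E T) w)"
  proof (rule Bochner_Integration.integral_cong[OF refl])
    fix w assume w: "w \<in> space M"
    then have "X w \<in> spanning_trees L" using measurable_space[OF X] by simp
    have "(\<Sum>T\<in>spanning_trees L. f T * indicator (?E T) w) =
        (\<Sum>T\<in>spanning_trees L. if T = X w then f T else 0)"
      using w by (intro sum.cong) (auto simp: indicator_def)
    then show "f (X w) = (\<Sum>T\<in>spanning_trees L. f T * indicator (?E T) w)"
      using \<open>X w \<in> spanning_trees L\<close> by simp
  qed
  also have "\<dots> = (\<Sum>T\<in>spanning_trees L. f T * measure M (?E T))"
  proof (subst Bochner_Integration.integral_sum)
    show "integrable M (\<lambda>w. f T * indicator (?E T) w)" if "T \<in> spanning_trees L" for T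
      using E[OF that] by (simp add: emeasure_eq_measure)
    have "expectation (\<lambda>w. f T * indicator (?E T) w) = f T * measure M (?E T)"
      if "T \<in> spanning_trees L" for T
      using E[OF that] by simp
    then show "(\<Sum>T\<in>spanning_trees L. expectation (\<lambda>w. f T * indicator (?E T) w)) =
        (\<Sum>T\<in>spanning_trees L. f T * measure M (?E T))"
      by (intro sum.cong) auto
  qed
  also have "\<dots> = (\<Sum>T\<in>spanning_trees L.
      f T * (tree_weight c T / (\<Sum>T'\<in>spanning_trees L. tree_weight c T')))"
    using assms by (intro sum.cong) (auto simp: random_spanning_tree_def)
  finally show ?thesis .
qed

theorem mainTheorem3:
  fixes L :: "'n::finite set set" and c :: "'n set \<Rightarrow> real"
    and M :: "'w measure" and X :: "'w \<Rightarrow> 'n set set"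
    and \<phi> :: "'n set set \<Rightarrow> 'n \<Rightarrow> complex"
    and \<gamma> :: "'n set set \<Rightarrow> 'n set \<Rightarrow> real \<Rightarrow> complex"
    and i :: 'n
  assumes "weighted_graph L c" and "graph_connected L"
    and "random_spanning_tree M L c X"
    and "\<And>T. T \<in> spanning_trees L \<Longrightarrow> plane_embedding T (\<phi> T) (\<gamma> T)"
  shows "node_resistance_curvature L c i =
    prob_space.expectation M (\<lambda>w. combinatorial_curvature (X w) (\<phi> (X w)) (\<gamma> (X w)) i)"
proof -
  define Z where "Z = (\<Sum>T\<in>spanning_trees L. tree_weight c T)"
  have total: "(\<Sum>T\<in>spanning_trees L. tree_weight c T / Z) = 1"
    using sum_tree_weight_pos[OF assms(1,2)] by (simp add: Z_def flip: sum_divide_distrib)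
  have curvature: "combinatorial_curvature T (\<phi> T) (\<gamma> T) i = 1 - degree T i / 2"
    if "T \<in> spanning_trees L" for T
  proof (rule combinatorial_curvature_tree)
    show "is_tree T" using that by (simp add: spanning_trees_def)
    show "\<forall>e\<in>T. card e = 2"
      using that assms(1) by (auto simp: spanning_trees_def weighted_graph_def)
  qed (use that assms(4) in simp)
  have "(\<Sum>j | {i, j} \<in> L. c {i, j} * effective_resistance L c i j) =
      (\<Sum>j | {i, j} \<in> L. (\<Sum>T | T \<in> spanning_trees L \<and> {i, j} \<in> T. tree_weight c T) / Z)"
    using link_weight_times_resistance[OF assms(1,2)] by (simp add: Z_def)
  also have "\<dots> = (\<Sum>T\<in>spanning_trees L. tree_weight c T * degree T i) / Z"
    by (simp only: sum_divide_distrib[symmetric] sum_trees_through_links_at[OF assms(1)])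
  finally have "node_resistance_curvature L c i =
      1 - 1/2 * ((\<Sum>T\<in>spanning_trees L. tree_weight c T * degree T i) / Z)"
    by (simp add: node_resistance_curvature_def)
  also have "\<dots> = (\<Sum>T\<in>spanning_trees L. tree_weight c T / Z) -
      1/2 * ((\<Sum>T\<in>spanning_trees L. tree_weight c T * degree T i) / Z)"
    by (simp only: total)
  also have "\<dots> = (\<Sum>T\<in>spanning_trees L. (1 - degree T i / 2) * (tree_weight c T / Z))"
    by (simp add: sum_divide_distrib sum_distrib_left right_diff_distrib left_diff_distrib
        diff_divide_distrib mult_ac flip: sum_subtractf)
  also have "\<dots> = (\<Sum>T\<in>spanning_trees L.
      combinatorial_curvature T (\<phi> T) (\<gamma> T) i * (tree_weight c T / Z))"
    by (intro sum.cong refl) (simp add: curvature)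
  also have "\<dots> = prob_space.expectation M (\<lambda>w. combinatorial_curvature (X w) (\<phi> (X w)) (\<gamma> (X w)) i)"
    using expectation_random_spanning_tree[OF assms(3),
        of "\<lambda>T. combinatorial_curvature T (\<phi> T) (\<gamma> T) i"] by (simp add: Z_def)
  finally show ?thesis .
qed

end
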